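(* Let $n\ge 1$ and let $i$ be an integer with $\frac{2}{3}n<i\le n$. If $f\in U_i(n,3)$ and $f\not\equiv 0$, then $$|f|\ge 2^{2i-n}\cdot 3^{n-i}.$$ Moreover, this bound is sharp: for all such $n,i$ there exists $f\in U_i(n,3)$, $f\not\equiv 0$, with $|f|=2^{2i-n}\cdot 3^{n-i}$.
   Context: For $q\ge 2$ let $\Sigma_q=\{0,1,\ldots,q-1\}$. The Hamming graph $H(n,q)$ has vertex set $\Sigma_q^n$, and two vertices are adjacent if they differ in exactly one coordinate. The eigenvalues of its adjacency matrix are $\lambda_i(n,q)=n(q-1)-q\cdot i$ for $0\le i\le n$. Let $U_i(n,q)$ be the $\lambda_i(n,q)$-eigenspace, i.e. the space of functions $f:\Sigma_q^n\to\mathbb{R}$ with $\lambda_i(n,q)f(x)=\sum_{y\in N(x)}f(y)$ for every vertex $x$, where $N(x)$ is the set of neighbors of $x$. For a function $f:\Sigma_q^n\to\mathbb{R}$, $|f|$ denotes the cardinality of its support $\{x : f(x)\ne 0\}$. *)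

theory Defs
  imports Complex_Main "HOL-Library.FuncSet"
begin

definition hamming_verts :: "nat \<Rightarrow> nat \<Rightarrow> nat list set" where
  "hamming_verts n q = {x. length x = n \<and> set x \<subseteq> {..<q}}"

definition hamming_nbrs :: "nat \<Rightarrow> nat \<Rightarrow> nat list \<Rightarrow> nat list set" where
  "hamming_nbrs n q x = {y \<in> hamming_verts n q. card {k. k < n \<and> x ! k \<noteq> y ! k} = 1}"

definition hamming_eigenvalue :: "nat \<Rightarrow> nat \<Rightarrow> nat \<Rightarrow> real" where
  "hamming_eigenvalue n q i = real n * (real q - 1) - real q * real i"

(* Real functions on the vertex set are represented extensionally, i.e. with the fixed value
   undefined outside it, so "f is not identically zero" must be stated relative to the vertices. *)
definition hamming_eigenspace :: "nat \<Rightarrow> nat \<Rightarrow> nat \<Rightarrow> (nat list \<Rightarrow> real) set" where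
  "hamming_eigenspace n q i =
    {f \<in> hamming_verts n q \<rightarrow>\<^sub>E UNIV.
      \<forall>x \<in> hamming_verts n q. hamming_eigenvalue n q i * f x = (\<Sum>y \<in> hamming_nbrs n q x. f y)}"

definition hamming_support :: "nat \<Rightarrow> nat \<Rightarrow> (nat list \<Rightarrow> real) \<Rightarrow> nat list set" where
  "hamming_support n q f = {x \<in> hamming_verts n q. f x \<noteq> 0}"

end

theory Submission
  imports Defs
begin

text \<open>
  The lower bound is an instance of an uncertainty principle that admits a short induction. For a
  nonzero \<open>f\<close> in \<open>U\<^sub>i(n,3) \<oplus> \<dots> \<oplus> U\<^sub>j(n,3)\<close> the claim is \<open>|f| \<ge> G\<close>, where
  \<open>G = 2^i * (3/2)^(n-j)\<close>; at \<open>i = j\<close> this is \<open>2^(2i-n) * 3^(n-i)\<close>. Cut \<open>H(n,3)\<close> along the first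
  coordinate into three copies of \<open>H(n-1,3)\<close>. Each slice of \<open>f\<close> has its spectrum in the window
  \<open>[i-1,j]\<close>, the difference of two slices in \<open>[i-1,j-1]\<close>, and the sum of all slices in \<open>[i,j]\<close>.

  \<^item> If no slice vanishes, each has support at least \<open>2^(i-1) * (3/2)^(n-1-j) = G/3\<close>.
  \<^item> If exactly one slice vanishes, each other slice is the difference of itself and the zero slice,
    so its support is at least \<open>2^(i-1) * (3/2)^(n-j) = G/2\<close>.
  \<^item> If two slices vanish, the remaining one is both such a difference and the sum of all slices, so
    its window is \<open>[i,j-1]\<close> and its support is at least \<open>2^i * (3/2)^(n-j) = G\<close>.

  In each case the supports add up to at least \<open>G\<close> (\<open>spectral_window_support_bound\<close>).

  For sharpness, two building blocks are tensored together: \<open>(1,-1,0)\<close> on \<open>H(1,3)\<close>, in \<open>U\<^sub>1(1,3)\<close>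
  with support 2, and the alternating function on \<open>H(3,3)\<close>, which lives on the 6 permutations of
  \<open>{0,1,2}\<close> and lies in \<open>U\<^sub>2(3,3)\<close>. Using \<open>m = 3i - 2n\<close> copies of the first and \<open>k = n - i\<close> of the
  second gives an element of \<open>U\<^sub>i(n,3)\<close> with support \<open>2^m * 6^k = 2^(2i-n) * 3^(n-i)\<close>
  (\<open>small_eigenfunction_exists\<close>). The condition on \<open>i\<close> makes \<open>m\<close> positive.
\<close>

section \<open>Slicing the Hamming graph along the first coordinate\<close>

lemma hamming_verts_0: "hamming_verts 0 q = {[]}"
  by (auto simp: hamming_verts_def)

lemma hamming_verts_Suc:
  "hamming_verts (Suc n) q = (\<Union>a<q. (#) a ` hamming_verts n q)"
  by (auto simp: hamming_verts_def length_Suc_conv image_iff)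

lemma Cons_in_hamming_verts:
  "a # x \<in> hamming_verts (Suc n) q \<longleftrightarrow> a < q \<and> x \<in> hamming_verts n q"
  by (auto simp: hamming_verts_def)

lemma finite_hamming_verts: "finite (hamming_verts n q)"
  by (induction n) (auto simp: hamming_verts_0 hamming_verts_Suc)

lemma finite_hamming_support: "finite (hamming_support n q f)"
  by (simp add: hamming_support_def finite_hamming_verts)

lemma card_hamming_support_Suc:
  "card (hamming_support (Suc n) q f) = (\<Sum>a<q. card (hamming_support n q (\<lambda>x. f (a # x))))"
proof -
  have "hamming_support (Suc n) q f = (\<Union>a<q. (#) a ` hamming_support n q (\<lambda>x. f (a # x)))"
    by (auto simp: hamming_support_def hamming_verts_Suc)
  also have "card \<dots> = (\<Sum>a<q. card ((#) a ` hamming_support n q (\<lambda>x. f (a # x))))"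
    by (rule card_UN_disjoint) (auto simp: finite_hamming_support)
  also have "\<dots> = (\<Sum>a<q. card (hamming_support n q (\<lambda>x. f (a # x))))"
    by (simp add: card_image)
  finally show ?thesis .
qed

lemma card_hamming_support_scale:
  "card (hamming_support n q (\<lambda>x. c * f x)) = (if c = 0 then 0 else card (hamming_support n q f))"
  by (simp add: hamming_support_def)

lemma card_differences_Cons:
  "card {k. k < Suc n \<and> (a # x) ! k \<noteq> (b # y) ! k} =
     (if a = b then 0 else 1) + card {k. k < n \<and> x ! k \<noteq> y ! k}"
proof -
  have "{k. k < Suc n \<and> (a # x) ! k \<noteq> (b # y) ! k} =
      (if a = b then {} else {0}) \<union> Suc ` {k. k < n \<and> x ! k \<noteq> y ! k}"
    by (auto simp: less_Suc_eq_0_disj)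
  then show ?thesis
    by (simp add: card_image)
qed

lemma hamming_nbrs_Cons:
  assumes "a < q" "x \<in> hamming_verts n q"
  shows "hamming_nbrs (Suc n) q (a # x) =
    (#) a ` hamming_nbrs n q x \<union> (\<lambda>b. b # x) ` ({..<q} - {a})"
proof -
  have agree: "card {k. k < n \<and> x ! k \<noteq> y ! k} = 0 \<longleftrightarrow> y = x" if "y \<in> hamming_verts n q" for y
    using that assms(2) by (auto simp: hamming_verts_def list_eq_iff_nth_eq)
  show ?thesis
  proof (rule set_eqI)
    fix z
    show "z \<in> hamming_nbrs (Suc n) q (a # x) \<longleftrightarrow>
      z \<in> (#) a ` hamming_nbrs n q x \<union> (\<lambda>b. b # x) ` ({..<q} - {a})"
    proof (cases z)
      case Nil
      then show ?thesis by (auto simp: hamming_nbrs_def hamming_verts_def)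
    next
      case (Cons b y)
      then show ?thesis
        using assms agree[of y]
        by (auto simp: hamming_nbrs_def Cons_in_hamming_verts card_differences_Cons image_iff)
    qed
  qed
qed

text \<open>
  \<open>H(n+1,q)\<close> is the Cartesian product of a complete graph with \<open>H(n,q)\<close>, so its adjacency operator is
  the sum of those of the factors. The complete graph contributes the full sum over the first
  coordinate minus the diagonal term.
\<close>
lemma sum_hamming_nbrs_Cons:
  fixes f :: "nat list \<Rightarrow> real"
  assumes "a < q" "x \<in> hamming_verts n q"
  shows "(\<Sum>y \<in> hamming_nbrs (Suc n) q (a # x). f y) =
    (\<Sum>y \<in> hamming_nbrs n q x. f (a # y)) + (\<Sum>b<q. f (b # x)) - f (a # x)"
proof -
  have fin: "finite (hamming_nbrs n q x)"
    by (simp add: hamming_nbrs_def finite_hamming_verts)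
  have "(\<Sum>y \<in> hamming_nbrs (Suc n) q (a # x). f y) =
      sum f ((#) a ` hamming_nbrs n q x) + sum f ((\<lambda>b. b # x) ` ({..<q} - {a}))"
    unfolding hamming_nbrs_Cons[OF assms] using fin by (intro sum.union_disjoint) auto
  also have "sum f ((\<lambda>b. b # x) ` ({..<q} - {a})) = (\<Sum>b\<in>{..<q} - {a}. f (b # x))"
    by (subst sum.reindex) (auto simp: inj_on_def)
  also have "\<dots> = (\<Sum>b<q. f (b # x)) - f (a # x)"
    using assms by (simp add: sum_diff1)
  finally show ?thesis
    by (simp add: sum.reindex)
qed

section \<open>Functions with spectrum in a window\<close>

text \<open>
  For \<open>q > 0\<close> this describes, by recursion on \<open>n\<close>, the space
  \<open>U\<^sub>i(n,q) \<oplus> U\<^sub>i\<^sub>+\<^sub>1(n,q) \<oplus> \<dots> \<oplus> U\<^sub>j(n,q)\<close>. Over the first coordinate a function splits into its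
  mean and a part of mean zero. The adjacency operator of the complete graph has eigenvalue \<open>q - 1\<close> on
  the former and \<open>-1\<close> on the latter, so only the mean-zero part, which the differences of
  slices capture, uses up one unit of the index. The bounds are integers, so that \<open>i - 1\<close> and
  \<open>j - 1\<close> may leave the range \<open>0..n\<close> without separate treatment of the boundary.
\<close>
fun spectral_window :: "nat \<Rightarrow> nat \<Rightarrow> int \<Rightarrow> int \<Rightarrow> (nat list \<Rightarrow> real) \<Rightarrow> bool" where
  "spectral_window 0 q i j f \<longleftrightarrow> f [] = 0 \<or> i \<le> 0 \<and> 0 \<le> j"
| "spectral_window (Suc n) q i j f \<longleftrightarrow>
     spectral_window n q i j (\<lambda>x. \<Sum>a<q. f (a # x)) \<and>
     (\<forall>a<q. \<forall>b<q. spectral_window n q (i - 1) (j - 1) (\<lambda>x. f (a # x) - f (b # x)))"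

lemma spectral_window_mono:
  assumes "spectral_window n q i j f" "i' \<le> i" "j \<le> j'"
  shows "spectral_window n q i' j' f"
  using assms
proof (induction n arbitrary: i j i' j' f)
  case (Suc n)
  show ?case
    using Suc.prems
    by (auto intro: Suc.IH[of i j _ i' j'] Suc.IH[of "i - 1" "j - 1" _ "i' - 1" "j' - 1"])
qed auto

lemma spectral_window_inter:
  assumes "spectral_window n q i j f" "spectral_window n q i' j' f"
  shows "spectral_window n q (max i i') (min j j') f"
  using assms
proof (induction n arbitrary: i j i' j' f)
  case (Suc n)
  have "max i i' - 1 = max (i - 1) (i' - 1)" "min j j' - 1 = min (j - 1) (j' - 1)" by auto
  then show ?case
    using Suc.prems by (auto intro: Suc.IH)
qed auto

lemma spectral_window_cong:
  assumes "\<And>x. x \<in> hamming_verts n q \<Longrightarrow> f x = g x"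
  shows "spectral_window n q i j f \<longleftrightarrow> spectral_window n q i j g"
  using assms
proof (induction n arbitrary: i j f g)
  case 0
  then show ?case by (simp add: hamming_verts_0)
next
  case (Suc n)
  have eq: "f (a # x) = g (a # x)" if "a < q" "x \<in> hamming_verts n q" for a x
    using that Suc.prems by (simp add: Cons_in_hamming_verts)
  have "spectral_window n q i j (\<lambda>x. \<Sum>a<q. f (a # x)) \<longleftrightarrow>
      spectral_window n q i j (\<lambda>x. \<Sum>a<q. g (a # x))"
    by (rule Suc.IH) (simp add: eq)
  moreover have "spectral_window n q (i - 1) (j - 1) (\<lambda>x. f (a # x) - f (b # x)) \<longleftrightarrow>
      spectral_window n q (i - 1) (j - 1) (\<lambda>x. g (a # x) - g (b # x))" if "a < q" "b < q" for a b
    by (rule Suc.IH) (simp add: eq that)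
  ultimately show ?case by simp
qed

lemma spectral_window_scale:
  assumes "spectral_window n q i j f"
  shows "spectral_window n q i j (\<lambda>x. c * f x)"
  using assms
  by (induction n arbitrary: i j f)
     (auto simp: sum_distrib_left[symmetric] right_diff_distrib[symmetric])

lemma spectral_window_add:
  assumes "spectral_window n q i j f" "spectral_window n q i j g"
  shows "spectral_window n q i j (\<lambda>x. f x + g x)"
  using assms
  by (induction n arbitrary: i j f g)
     (auto simp: sum.distrib add_diff_add)

lemma spectral_window_sum:
  assumes "\<And>a. a \<in> A \<Longrightarrow> spectral_window n q i j (f a)"
  shows "spectral_window n q i j (\<lambda>x. \<Sum>a\<in>A. f a x)"
proof -
  have "spectral_window n q i j (\<lambda>x. 0)"
    by (induction n arbitrary: i j) auto
  with assms show ?thesis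
    by (induction A rule: infinite_finite_induct) (auto intro: spectral_window_add)
qed

text \<open>
  A slice is the average of all slices plus the average of its differences to them; the two parts
  have windows \<open>[i,j]\<close> and \<open>[i-1,j-1]\<close>.
\<close>
lemma spectral_window_slice:
  assumes "spectral_window (Suc n) q i j f" "a < q"
  shows "spectral_window n q (i - 1) j (\<lambda>x. f (a # x))"
proof -
  have "spectral_window n q (i - 1) j (\<lambda>x. \<Sum>b<q. f (b # x))"
    using assms by (auto intro: spectral_window_mono)
  moreover have "spectral_window n q (i - 1) j (\<lambda>x. \<Sum>b<q. f (a # x) - f (b # x))"
    by (rule spectral_window_sum, rule spectral_window_mono[of _ _ "i - 1" "j - 1"])
       (use assms in auto)
  ultimately have "spectral_window n q (i - 1) j (\<lambda>x. (1 / real q) *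
      ((\<Sum>b<q. f (b # x)) + (\<Sum>b<q. f (a # x) - f (b # x))))"
    by (intro spectral_window_scale spectral_window_add)
  then show ?thesis
    using assms(2) by (simp add: sum_subtractf)
qed

text \<open>
  Extensionality is left out and the eigenvalue is an arbitrary real, since slices, sums
  and tensor products are formed without regard to values outside the vertex set.
\<close>
definition hamming_eigenfunction :: "nat \<Rightarrow> nat \<Rightarrow> real \<Rightarrow> (nat list \<Rightarrow> real) \<Rightarrow> bool" where
  "hamming_eigenfunction n q lam f \<longleftrightarrow>
     (\<forall>x \<in> hamming_verts n q. lam * f x = (\<Sum>y \<in> hamming_nbrs n q x. f y))"

lemma hamming_eigenfunction_Suc:
  "hamming_eigenfunction (Suc n) q lam f \<longleftrightarrow>
    (\<forall>a<q. \<forall>x \<in> hamming_verts n q. (lam + 1) * f (a # x) =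
       (\<Sum>y \<in> hamming_nbrs n q x. f (a # y)) + (\<Sum>b<q. f (b # x)))"
  by (auto simp: hamming_eigenfunction_def hamming_verts_Suc sum_hamming_nbrs_Cons algebra_simps)

text \<open>
  Let \<open>A\<close> be the adjacency operator of \<open>H(n,q)\<close>, let \<open>f\<^sub>a\<close> be the slices and \<open>S\<close> their sum. The eigenvalue
  equation is \<open>(\<lambda> + 1) f\<^sub>a = A f\<^sub>a + S\<close> for every \<open>a\<close>. Subtracting two of these gives eigenvalue \<open>\<lambda> + 1\<close>
  for \<open>f\<^sub>a - f\<^sub>b\<close>, and adding all of them gives eigenvalue \<open>\<lambda> + 1 - q\<close> for \<open>S\<close>. For \<open>\<lambda> = \<lambda>\<^sub>i(n+1,q)\<close>
  these are \<open>\<lambda>\<^sub>i\<^sub>-\<^sub>1(n,q)\<close> and \<open>\<lambda>\<^sub>i(n,q)\<close>.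
\<close>
lemma eigenfunction_spectral_window:
  assumes "hamming_eigenfunction n q (real n * (real q - 1) - real q * of_int i) f" "q > 0"
  shows "spectral_window n q i i f"
  using assms
proof (induction n arbitrary: i f)
  case 0
  have "hamming_nbrs 0 q [] = {}"
    by (simp add: hamming_nbrs_def)
  with 0 show ?case
    by (auto simp: hamming_eigenfunction_def hamming_verts_0)
next
  case (Suc n)
  define lam where "lam = real (Suc n) * (real q - 1) - real q * of_int i"
  have eq: "(\<Sum>y \<in> hamming_nbrs n q x. f (a # y)) = (lam + 1) * f (a # x) - (\<Sum>b<q. f (b # x))"
    if "a < q" "x \<in> hamming_verts n q" for a x
    using Suc.prems(1) that by (simp add: hamming_eigenfunction_Suc lam_def)
  have lam_sum: "real n * (real q - 1) - real q * of_int i = lam + 1 - real q"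
    and lam_diff: "real n * (real q - 1) - real q * of_int (i - 1) = lam + 1"
    by (simp_all add: lam_def algebra_simps)
  have "hamming_eigenfunction n q (real n * (real q - 1) - real q * of_int i)
      (\<lambda>x. \<Sum>a<q. f (a # x))"
    unfolding hamming_eigenfunction_def lam_sum
  proof
    fix x assume x: "x \<in> hamming_verts n q"
    have "(\<Sum>y \<in> hamming_nbrs n q x. \<Sum>a<q. f (a # y)) =
        (\<Sum>a<q. \<Sum>y \<in> hamming_nbrs n q x. f (a # y))"
      by (rule sum.swap)
    also have "\<dots> = (\<Sum>a<q. (lam + 1) * f (a # x) - (\<Sum>b<q. f (b # x)))"
      using x by (simp add: eq)
    also have "\<dots> = (lam + 1 - real q) * (\<Sum>a<q. f (a # x))"
      by (simp add: sum_subtractf sum_distrib_left[symmetric] left_diff_distrib)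
    finally show "(lam + 1 - real q) * (\<Sum>a<q. f (a # x)) =
        (\<Sum>y \<in> hamming_nbrs n q x. \<Sum>a<q. f (a # y))" ..
  qed
  moreover have "hamming_eigenfunction n q (real n * (real q - 1) - real q * of_int (i - 1))
      (\<lambda>x. f (a # x) - f (b # x))" if "a < q" "b < q" for a b
    unfolding hamming_eigenfunction_def lam_diff
    using that by (simp add: sum_subtractf eq right_diff_distrib)
  ultimately show ?case
    using Suc.IH Suc.prems(2) by simp
qed

section \<open>The lower bound\<close>

text \<open>
  Going from \<open>n + 1\<close> to \<open>n\<close> multiplies the bound by \<open>2/3\<close>, lowering \<open>i\<close> divides it by 2, and
  lowering \<open>j\<close> multiplies it by \<open>3/2\<close>. Each nonzero slice therefore contributes at least a
  third, a half or the whole of the bound when three, two or one of the slices are nonzero.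
\<close>
lemma spectral_window_support_bound:
  assumes "spectral_window n 3 i j f" "hamming_support n 3 f \<noteq> {}"
  shows "2 powi i * (3/2) powi (int n - j) \<le> real (card (hamming_support n 3 f))"
  using assms
proof (induction n arbitrary: i j f)
  case 0
  then have ij: "i \<le> 0" "0 \<le> j"
    by (auto simp: hamming_support_def hamming_verts_0)
  have "hamming_support 0 3 f = {[]}"
    using 0 by (auto simp: hamming_support_def hamming_verts_0)
  moreover have "2 powi i \<le> (1::real)" "(3/2) powi (- j) \<le> (1::real)"
    using ij power_int_increasing[of i 0 "2::real"] power_int_increasing[of "-j" 0 "3/2::real"]
    by simp_all
  ultimately show ?case
    by (simp add: mult_le_one)
next
  case (Suc n)
  define G :: real where "G = 2 powi i * (3/2) powi (int (Suc n) - j)"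
  define S where "S a = hamming_support n 3 (\<lambda>x. f (a # x))" for a
  have total: "card (hamming_support (Suc n) 3 f) = card (S 0) + card (S 1) + card (S 2)"
    by (simp add: card_hamming_support_Suc S_def numeral_3_eq_3 eval_nat_numeral)
  have third: "G / 3 \<le> card (S a)" if "a < 3" "S a \<noteq> {}" for a
  proof -
    have "2 powi (i - 1) * (3/2) powi (int n - j) \<le> real (card (S a))"
      using that Suc.prems(1) unfolding S_def by (intro Suc.IH spectral_window_slice) auto
    moreover have "G = 3 * (2 powi (i - 1) * (3/2) powi (int n - j))"
      using power_int_add_1[of "2::real" "i - 1"] power_int_add_1[of "3/2::real" "int n - j"]
      by (simp add: G_def algebra_simps)
    ultimately show ?thesis by simp
  qed
  have window_of_vanishing: "spectral_window n 3 (i - 1) (j - 1) (\<lambda>x. f (a # x))"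
    if "a < 3" "b < 3" "S b = {}" for a b
  proof -
    have "spectral_window n 3 (i - 1) (j - 1) (\<lambda>x. f (a # x) - f (b # x))"
      using Suc.prems(1) that by simp
    then show ?thesis
      using that(3)
      by (subst spectral_window_cong[of _ _ _ "\<lambda>x. f (a # x) - f (b # x)"])
         (auto simp: S_def hamming_support_def)
  qed
  have half: "G / 2 \<le> card (S a)" if "a < 3" "b < 3" "S a \<noteq> {}" "S b = {}" for a b
  proof -
    have "2 powi (i - 1) * (3/2) powi (int n - (j - 1)) \<le> real (card (S a))"
      using that unfolding S_def by (intro Suc.IH window_of_vanishing[of a b]) (auto simp: S_def)
    moreover have "G = 2 * (2 powi (i - 1) * (3/2) powi (int n - (j - 1)))"
      using power_int_add_1[of "2::real" "i - 1"]
      by (simp add: G_def algebra_simps)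
    ultimately show ?thesis by simp
  qed
  have three: "{..<3} = {0, 1, 2::nat}"
    by auto
  have whole: "G \<le> card (S a)"
    if abc: "{..<3} = {a, b, c}" and distinct: "a \<noteq> b" "a \<noteq> c" "b \<noteq> c"
      and "S a \<noteq> {}" "S b = {}" "S c = {}" for a b c
  proof -
    have less: "a < 3" "b < 3"
      using abc by blast+
    have "(\<Sum>d<3. f (d # x)) = f (a # x)" if "x \<in> hamming_verts n 3" for x
      using distinct \<open>S b = {}\<close> \<open>S c = {}\<close> that by (auto simp: abc S_def hamming_support_def)
    then have "spectral_window n 3 i j (\<lambda>x. \<Sum>d<3. f (d # x)) \<longleftrightarrow>
        spectral_window n 3 i j (\<lambda>x. f (a # x))"
      by (rule spectral_window_cong)
    then have "spectral_window n 3 i j (\<lambda>x. f (a # x))"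
      using Suc.prems(1) unfolding spectral_window.simps by blast
    moreover have "spectral_window n 3 (i - 1) (j - 1) (\<lambda>x. f (a # x))"
      using less \<open>S b = {}\<close> by (rule window_of_vanishing)
    ultimately have "spectral_window n 3 (max i (i - 1)) (min j (j - 1)) (\<lambda>x. f (a # x))"
      by (rule spectral_window_inter)
    then have "spectral_window n 3 i (j - 1) (\<lambda>x. f (a # x))"
      by simp
    then have "2 powi i * (3/2) powi (int n - (j - 1)) \<le> real (card (S a))"
      using that unfolding S_def by (intro Suc.IH)
    then show ?thesis
      by (simp add: G_def algebra_simps)
  qed
  have "\<not> (S 0 = {} \<and> S 1 = {} \<and> S 2 = {})"
  proof
    assume "S 0 = {} \<and> S 1 = {} \<and> S 2 = {}"
    then have "card (hamming_support (Suc n) 3 f) = 0"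
      by (simp add: total)
    with Suc.prems(2) show False
      by (simp add: finite_hamming_support)
  qed
  moreover have "finite (S a)" for a
    by (simp add: S_def finite_hamming_support)
  ultimately have "G \<le> real (card (S 0)) + card (S 1) + card (S 2)"
    using third[of 0] third[of 1] third[of 2]
      half[of 0 1] half[of 0 2] half[of 1 0] half[of 1 2] half[of 2 0] half[of 2 1]
      whole[of 0 1 2] whole[of 1 0 2] whole[of 2 0 1]
    by (cases "S 0 = {}"; cases "S 1 = {}"; cases "S 2 = {}") (simp_all add: three insert_commute)
  then show ?case
    by (simp add: total G_def)
qed

section \<open>Sharpness\<close>

definition prepend_difference :: "(nat list \<Rightarrow> real) \<Rightarrow> nat list \<Rightarrow> real" where
  "prepend_difference f x = (if hd x = 0 then 1 else if hd x = 1 then - 1 else 0) * f (tl x)"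

lemma eigenfunction_prepend_difference:
  assumes "hamming_eigenfunction n 3 lam f"
  shows "hamming_eigenfunction (Suc n) 3 (lam - 1) (prepend_difference f)"
    and "card (hamming_support (Suc n) 3 (prepend_difference f)) =
      2 * card (hamming_support n 3 f)"
proof -
  define g :: "nat \<Rightarrow> real" where "g a = (if a = 0 then 1 else if a = 1 then - 1 else 0)" for a
  have Cons: "prepend_difference f (a # x) = g a * f x" for a x
    by (simp add: prepend_difference_def g_def)
  have "(\<Sum>b<3. g b) = 0"
    by (simp add: g_def eval_nat_numeral)
  then show "hamming_eigenfunction (Suc n) 3 (lam - 1) (prepend_difference f)"
    using assms unfolding hamming_eigenfunction_Suc Cons
    by (simp add: hamming_eigenfunction_def sum_distrib_left[symmetric] sum_distrib_right[symmetric])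
  show "card (hamming_support (Suc n) 3 (prepend_difference f)) =
      2 * card (hamming_support n 3 f)"
    unfolding card_hamming_support_Suc Cons card_hamming_support_scale
    by (simp add: g_def eval_nat_numeral)
qed

text \<open>
  On \<open>{0,1,2}\<close> this is twice the sign of \<open>(a,b,c)\<close> as a permutation, and 0 if two entries agree.
\<close>
definition vandermonde :: "nat \<Rightarrow> nat \<Rightarrow> nat \<Rightarrow> real" where
  "vandermonde a b c = (real b - real a) * (real c - real a) * (real c - real b)"

definition prepend_vandermonde :: "(nat list \<Rightarrow> real) \<Rightarrow> nat list \<Rightarrow> real" where
  "prepend_vandermonde f x = vandermonde (x ! 0) (x ! 1) (x ! 2) * f (drop 3 x)"

lemma prepend_vandermonde_Cons:
  "prepend_vandermonde f (a # b # c # x) = vandermonde a b c * f x"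
  by (simp add: prepend_vandermonde_def)

text \<open>
  The alternating function on \<open>H(3,3)\<close> has eigenvalue 0. A permutation has no permutation as a
  neighbour. A word of type \<open>aab\<close> has two, obtained by changing one of the equal letters into the
  missing letter; they differ by a transposition, so their signs cancel. A constant word has none.
\<close>
lemma eigenfunction_prepend_vandermonde:
  assumes "hamming_eigenfunction n 3 lam f"
  shows "hamming_eigenfunction (n + 3) 3 lam (prepend_vandermonde f)"
    and "card (hamming_support (n + 3) 3 (prepend_vandermonde f)) =
      6 * card (hamming_support n 3 f)"
proof -
  have n3: "n + 3 = Suc (Suc (Suc n))" by simp
  (* Each sum along a line counts the centre once, whence the three copies on the right. *)
  have cancel: "(\<Sum>b'<3. vandermonde a b' c) + (\<Sum>a'<3. vandermonde a' b c)
      + (\<Sum>c'<3. vandermonde a b c') = 3 * vandermonde a b c"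
    if "a < 3" "b < 3" "c < 3" for a b c
  proof -
    have "a \<in> {0, 1, 2}" "b \<in> {0, 1, 2}" "c \<in> {0, 1, 2}" using that by auto
    then show ?thesis by (auto simp: vandermonde_def eval_nat_numeral)
  qed
  show "hamming_eigenfunction (n + 3) 3 lam (prepend_vandermonde f)"
    unfolding hamming_eigenfunction_def
  proof
    fix z assume "z \<in> hamming_verts (n + 3) 3"
    then obtain a b c x where z: "z = a # b # c # x"
      and abc: "a < 3" "b < 3" "c < 3" and x: "x \<in> hamming_verts n 3"
      by (auto simp: n3 hamming_verts_Suc)
    have "(\<Sum>y \<in> hamming_nbrs (n + 3) 3 z. prepend_vandermonde f y) =
        vandermonde a b c * (\<Sum>y \<in> hamming_nbrs n 3 x. f y)
        + ((\<Sum>b'<3. vandermonde a b' c) + (\<Sum>a'<3. vandermonde a' b c)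
           + (\<Sum>c'<3. vandermonde a b c') - 3 * vandermonde a b c) * f x"
      using abc x unfolding z n3
      by (simp add: sum_hamming_nbrs_Cons Cons_in_hamming_verts prepend_vandermonde_Cons
          sum_distrib_left[symmetric] sum_distrib_right[symmetric] algebra_simps)
    also have "\<dots> = vandermonde a b c * (lam * f x)"
      using assms x cancel[OF abc] by (simp add: hamming_eigenfunction_def)
    finally show "lam * prepend_vandermonde f z =
        (\<Sum>y \<in> hamming_nbrs (n + 3) 3 z. prepend_vandermonde f y)"
      by (simp add: z prepend_vandermonde_Cons)
  qed
  show "card (hamming_support (n + 3) 3 (prepend_vandermonde f)) =
      6 * card (hamming_support n 3 f)"
    unfolding n3 card_hamming_support_Suc prepend_vandermonde_Cons card_hamming_support_scale
    by (simp add: vandermonde_def eval_nat_numeral)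
qed

text \<open>
  With \<open>n = m + 3k\<close> and \<open>i = m + 2k\<close> the eigenvalue \<open>2n - 3i\<close> is \<open>-m\<close>.
\<close>
lemma small_eigenfunction_exists:
  "\<exists>f. hamming_eigenfunction (m + 3 * k) 3 (- real m) f \<and>
       card (hamming_support (m + 3 * k) 3 f) = 2 ^ m * 6 ^ k"
proof (induction k)
  case 0
  show ?case
  proof (induction m)
    case 0
    have "hamming_eigenfunction 0 3 0 (\<lambda>x. 1)"
      by (simp add: hamming_eigenfunction_def hamming_verts_0 hamming_nbrs_def)
    moreover have "card (hamming_support 0 3 (\<lambda>x. 1)) = 1"
      by (simp add: hamming_support_def hamming_verts_0)
    ultimately show ?case by auto
  next
    case (Suc m)
    then obtain f where f: "hamming_eigenfunction m 3 (- real m) f"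
      "card (hamming_support m 3 f) = 2 ^ m"
      by auto
    have "- real (Suc m) = - real m - 1" by simp
    with eigenfunction_prepend_difference[OF f(1)] show ?case
      by (metis f(2) add.right_neutral mult_0_right power_0 mult_1_right power_Suc)
  qed
next
  case (Suc k)
  then obtain f where f: "hamming_eigenfunction (m + 3 * k) 3 (- real m) f"
    "card (hamming_support (m + 3 * k) 3 f) = 2 ^ m * 6 ^ k"
    by auto
  have "m + 3 * Suc k = m + 3 * k + 3" "6 * (2 ^ m * 6 ^ k) = (2 ^ m * 6 ^ Suc k :: nat)"
    by simp_all
  with eigenfunction_prepend_vandermonde[OF f(1)] show ?case
    by (metis f(2))
qed

theorem corollary2:
  fixes n i :: nat
  assumes "n \<ge> 1"
    and "2 / 3 * real n < real i"
    and "i \<le> n"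
  shows "(\<forall>f \<in> hamming_eigenspace n 3 i. (\<exists>x \<in> hamming_verts n 3. f x \<noteq> 0) \<longrightarrow>
            card (hamming_support n 3 f) \<ge> 2 ^ (2 * i - n) * 3 ^ (n - i))
       \<and> (\<exists>f \<in> hamming_eigenspace n 3 i. (\<exists>x \<in> hamming_verts n 3. f x \<noteq> 0) \<and>
            card (hamming_support n 3 f) = 2 ^ (2 * i - n) * 3 ^ (n - i))"
proof (intro conjI ballI impI)
  fix f
  assume f: "f \<in> hamming_eigenspace n 3 i" and nz: "\<exists>x \<in> hamming_verts n 3. f x \<noteq> 0"
  have "hamming_eigenfunction n 3 (real n * (real 3 - 1) - real 3 * of_int (int i)) f"
    using f by (simp add: hamming_eigenspace_def hamming_eigenfunction_def hamming_eigenvalue_def)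
  then have "spectral_window n 3 (int i) (int i) f"
    by (rule eigenfunction_spectral_window) simp
  then have "2 powi int i * (3/2) powi (int n - int i) \<le> real (card (hamming_support n 3 f))"
    using nz by (intro spectral_window_support_bound) (auto simp: hamming_support_def)
  also have "2 powi int i * (3/2) powi (int n - int i) = (2 ^ i * (3/2) ^ (n - i) :: real)"
    using assms(3) by (simp flip: of_nat_diff)
  also have "\<dots> = 2 ^ (2 * i - n) * 3 ^ (n - i)"
  proof -
    have "i = (2 * i - n) + (n - i)"
      using assms by linarith
    then have "(2::real) ^ i = 2 ^ (2 * i - n) * 2 ^ (n - i)"
      by (metis power_add)
    then show ?thesis
      by (simp add: power_divide)
  qed
  finally have "real (2 ^ (2 * i - n) * 3 ^ (n - i)) \<le> real (card (hamming_support n 3 f))"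
    by simp
  then show "2 ^ (2 * i - n) * 3 ^ (n - i) \<le> card (hamming_support n 3 f)"
    unfolding of_nat_le_iff .
next
  define k m where "k = n - i" and "m = 3 * i - 2 * n"
  have "2 * real n < 3 * real i"
    using assms(2) by simp
  then have "2 * n < 3 * i"
    by linarith
  then have n: "n = m + 3 * k" and i: "i = m + 2 * k"
    using assms(3) by (simp_all add: k_def m_def)
  have lam: "hamming_eigenvalue n 3 i = - real m"
    by (simp add: hamming_eigenvalue_def n i)
  have size: "2 ^ (2 * i - n) * 3 ^ (n - i) = (2 ^ m * 6 ^ k :: nat)"
    by (simp add: n i power_add power_mult_distrib[symmetric])
  obtain f where f: "hamming_eigenfunction n 3 (- real m) f"
    "card (hamming_support n 3 f) = 2 ^ m * 6 ^ k"
    using small_eigenfunction_exists[of m k] n by auto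
  define g where "g = restrict f (hamming_verts n 3)"
  have "hamming_nbrs n 3 x \<subseteq> hamming_verts n 3" for x
    by (auto simp: hamming_nbrs_def)
  then have "(\<Sum>y \<in> hamming_nbrs n 3 x. g y) = (\<Sum>y \<in> hamming_nbrs n 3 x. f y)" for x
    unfolding g_def by (intro sum.cong) auto
  then have "g \<in> hamming_eigenspace n 3 i"
    using f(1) by (simp add: hamming_eigenspace_def hamming_eigenfunction_def lam g_def)
  moreover have card: "card (hamming_support n 3 g) = 2 ^ m * 6 ^ k"
    unfolding f(2)[symmetric]
    by (rule arg_cong[where f = card]) (auto simp: hamming_support_def g_def)
  moreover have "\<exists>x \<in> hamming_verts n 3. g x \<noteq> 0"
  proof (rule ccontr)
    assume "\<not> ?thesis"
    then have "hamming_support n 3 g = {}"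
      by (auto simp: hamming_support_def)
    with card show False by simp
  qed
  ultimately show "\<exists>f \<in> hamming_eigenspace n 3 i. (\<exists>x \<in> hamming_verts n 3. f x \<noteq> 0) \<and>
      card (hamming_support n 3 f) = 2 ^ (2 * i - n) * 3 ^ (n - i)"
    unfolding size by blast
qed

end
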